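(* Let $\mathcal M=\mathbb C\cup\{\infty\}$ be the Riemann sphere with $S_+=0$ and $S_-=\infty$. Then the generalized Heisenberg Krichever-Novikov vertex algebra of $(\mathcal M,S_\pm)$ is the same as the (usual) Heisenberg vertex algebra: the generalized Heisenberg algebra is the Heisenberg algebra $[A_n,A_m]=n\delta_{n,-m}1$, the space of states and the vacuum are the same, the translation operators coincide, and the KN vertex operators coincide with the vertex operators of the Heisenberg vertex algebra.
   Context: **Generalized Heisenberg KN vertex algebra in genus $0$.** For $\mathcal M=\mathbb C\cup\{\infty\}$, $S_+=0$, $S_-=\infty$, the Krichever-Novikov data are $A_n(z)=z^n$, $\omega^n(z)=z^{-n-1}dz$ ($n\in\mathbb Z$), $e(z)=\frac{\partial}{\partial z}$; $\mathrm{Res}$ is the residue at $z=0$; $\nabla=\nabla_e$ is the Lie derivative along $e$, $\nabla(h(z)(dz)^\lambda)=h'(z)(dz)^\lambda$; $\langle\cdot,\cdot\rangle$ is the pairing of 1-forms and vector fields. The generalized Heisenberg algebra $\hat{\mathcal A}$ has generators $A_n$ ($n\in\mathbb Z$) and central $1$, with $[A_n,A_m]=\gamma_{nm}1$, $\gamma_{nm}=\mathrm{Res}(A_m(z)\,dA_n(z))$. $V=U(\hat{\mathcal A})\otimes_{U(\hat{\mathcal A}_+)}\mathbb C$, where $\hat{\mathcal A}_+$ is spanned by $1$ and $A_n$, $n\ge0$, with $A_n$ ($n\ge0$) acting on $\mathbb C$ by $0$ and $1$ by the identity; $|0\rangle=1\otimes1$. The translation operator is given by $T|0\rangle=0$,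 $[T,A_m]=\sum_{n}\xi_m^nA_n$, $\xi_m^n=-\mathrm{Res}(\langle\omega^n,e\rangle\,dA_m)$. The KN vertex operators are: $Y(|0\rangle,z)=\mathrm{Id}$; $Y(A_{-1}|0\rangle,z)=\sum_nA_n\langle\omega^n(z),e(z)\rangle$; $Y(A_{-m-1}|0\rangle,z)=\frac1{m!}\nabla^mY(A_{-1}|0\rangle,z)$; and for $n_1\ge\dots\ge n_m\ge0$, $Y(A_{-n_1-1}\cdots A_{-n_m-1}|0\rangle,z)$ is the right-nested KN normal ordered product of the $Y(A_{-n_i-1}|0\rangle,z)$. Here, for $a(z)=\sum_na_n\langle\omega^n(z),e(z)\rangle$, the KN normal ordered product is $:a(z)b(z):\;=\sum_{n<0}a_n\langle\omega^n(z),e(z)\rangle b(z)+b(z)\sum_{n\ge0}a_n\langle\omega^n(z),e(z)\rangle$. **Heisenberg vertex algebra.** The Heisenberg algebra has basis $b_n$ ($n\in\mathbb Z$) and central $1$ with $[b_n,b_m]=n\delta_{n,-m}1$. The state space is the Fock module induced from the one-dimensional representation of the span of $1$ and $b_n$ ($n\ge0$) with $b_n\mapsto0$, $1\mapsto\mathrm{id}$, with vacuum $|0\rangle$ the generating vector. Translation: $T|0\rangle=0$, $[T,b_n]=-nb_{n-1}$. Vertex operators: $Y(b_{-1}|0\rangle,z)=b(z)=\sum_nb_nz^{-n-1}$ and $Y(b_{-n_1-1}\cdots b_{-n_m-1}|0\rangle,z)=\frac1{n_1!\cdots n_m!}:\partial_z^{n_1}b(z)\cdots\partial_z^{n_m}b(z):$,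 with the right-nested normal ordered product $:a(z)c(z):\;=a(z)_+c(z)+c(z)a(z)_-$, where for $a(z)=\sum a_nz^{-n-1}$, $a(z)_+=\sum_{n<0}a_nz^{-n-1}$ and $a(z)_-=\sum_{n\ge0}a_nz^{-n-1}$. *)

theory Defs
  imports
    "HOL-Complex_Analysis.Complex_Analysis"
    "HOL-Algebra.Algebra"
begin

section \<open>Universal enveloping algebras\<close>

text \<open>
  A complex Lie algebra with basis \<open>B :: 'b set\<close> is the space of all \<open>x :: 'b \<Rightarrow>\<^sub>0 complex\<close>
  with \<open>keys x \<subseteq> B\<close>, together with a bracket.  With lists as the free monoid,
  \<open>'b list \<Rightarrow>\<^sub>0 complex\<close> is the free associative algebra on \<open>'b\<close>, i.e. the tensor algebra
  of \<open>'b \<Rightarrow>\<^sub>0 complex\<close>.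
\<close>

instantiation list :: (type) monoid_add
begin

definition zero_list :: "'a list" where "zero_list = []"
definition plus_list :: "'a list \<Rightarrow> 'a list \<Rightarrow> 'a list" where "plus_list = append"

instance by standard (simp_all add: zero_list_def plus_list_def)

end

definition tensor_algebra :: "'b set \<Rightarrow> ('b list \<Rightarrow>\<^sub>0 complex) ring" where
  "tensor_algebra B = \<lparr>carrier = {p. Poly_Mapping.keys p \<subseteq> lists B}, mult = (*), one = 1, ring.zero = 0, add = (+)\<rparr>"

definition to_tensor :: "('b \<Rightarrow>\<^sub>0 complex) \<Rightarrow> ('b list \<Rightarrow>\<^sub>0 complex)" where
  "to_tensor x = (\<Sum>g\<in>Poly_Mapping.keys x. Poly_Mapping.single [g] (Poly_Mapping.lookup x g))"

type_synonym 'b bracket = "('b \<Rightarrow>\<^sub>0 complex) \<Rightarrow> ('b \<Rightarrow>\<^sub>0 complex) \<Rightarrow> ('b \<Rightarrow>\<^sub>0 complex)"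

definition envelope_ideal :: "'b set \<Rightarrow> 'b bracket \<Rightarrow> ('b list \<Rightarrow>\<^sub>0 complex) set" where
  "envelope_ideal B br = genideal (tensor_algebra B)
     {to_tensor x * to_tensor y - to_tensor y * to_tensor x - to_tensor (br x y) | x y.
        Poly_Mapping.keys x \<subseteq> B \<and> Poly_Mapping.keys y \<subseteq> B}"

definition envelope :: "'b set \<Rightarrow> 'b bracket \<Rightarrow> ('b list \<Rightarrow>\<^sub>0 complex) set ring" where
  "envelope B br = tensor_algebra B Quot envelope_ideal B br"

definition envelope_class :: "'b set \<Rightarrow> 'b bracket \<Rightarrow> ('b list \<Rightarrow>\<^sub>0 complex) \<Rightarrow> ('b list \<Rightarrow>\<^sub>0 complex) set" where
  "envelope_class B br p = envelope_ideal B br +>\<^bsub>tensor_algebra B\<^esub> p"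

text \<open>
  For \<open>B' \<subseteq> B\<close> spanning a Lie subalgebra: the homomorphism from the envelope of the subalgebra
  to the envelope of the whole algebra, and the algebra homomorphism to the complex numbers which
  extends the one-dimensional representation \<open>\<rho>\<close> (given on the basis) of the subalgebra.
\<close>

definition envelope_incl :: "'b set \<Rightarrow> 'b bracket \<Rightarrow> ('b list \<Rightarrow>\<^sub>0 complex) set \<Rightarrow> ('b list \<Rightarrow>\<^sub>0 complex) set" where
  "envelope_incl B br s = the_elem (envelope_class B br ` s)"

definition envelope_char :: "('b \<Rightarrow> complex) \<Rightarrow> ('b list \<Rightarrow>\<^sub>0 complex) set \<Rightarrow> complex" where
  "envelope_char \<rho> s =
     the_elem ((\<lambda>p. \<Sum>w\<in>Poly_Mapping.keys p. Poly_Mapping.lookup p w * prod_list (map \<rho> w)) ` s)"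


section \<open>Induced modules\<close>

text \<open>
  Tensor product over \<open>S\<close> of a right \<open>S\<close>-module \<open>M\<close> and a left \<open>S\<close>-module on the type \<open>'n\<close>:
  the free abelian group on pairs modulo the biadditivity and balancing relations.
\<close>

definition tensor_relations ::
    "'s set \<Rightarrow> ('m, 'x) ring_scheme \<Rightarrow> ('m \<Rightarrow> 's \<Rightarrow> 'm) \<Rightarrow> ('s \<Rightarrow> 'n \<Rightarrow> 'n) \<Rightarrow>
      ('m \<times> 'n::ab_group_add \<Rightarrow>\<^sub>0 int) set" where
  "tensor_relations S M ract lact =
     {frag_of (m \<oplus>\<^bsub>M\<^esub> m', n) - frag_of (m, n) - frag_of (m', n) | m m' n.
        m \<in> carrier M \<and> m' \<in> carrier M} \<union>
     {frag_of (m, n + n') - frag_of (m, n) - frag_of (m, n') | m n n'. m \<in> carrier M} \<union>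
     {frag_of (ract m s, n) - frag_of (m, lact s n) | m s n. m \<in> carrier M \<and> s \<in> S}"

text \<open>
  The module induced from the one-dimensional representation \<open>\<rho>\<close> of the Lie subalgebra
  with basis \<open>B'\<close> of the Lie algebra with basis \<open>B\<close>.
\<close>

type_synonym 'b induced = "(('b list \<Rightarrow>\<^sub>0 complex) set \<times> complex \<Rightarrow>\<^sub>0 int) set"

definition induced_pairs :: "'b set \<Rightarrow> 'b bracket \<Rightarrow> (('b list \<Rightarrow>\<^sub>0 complex) set \<times> complex \<Rightarrow>\<^sub>0 int) monoid" where
  "induced_pairs B br = free_Abelian_group (carrier (envelope B br) \<times> UNIV)"

definition induced_kernel :: "'b set \<Rightarrow> 'b bracket \<Rightarrow> 'b set \<Rightarrow> ('b \<Rightarrow> complex) \<Rightarrow> 'b induced" where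
  "induced_kernel B br B' \<rho> = generate (induced_pairs B br)
     (tensor_relations (carrier (envelope B' br)) (envelope B br)
        (\<lambda>u s. u \<otimes>\<^bsub>envelope B br\<^esub> envelope_incl B br s) (\<lambda>s c. envelope_char \<rho> s * c))"

definition induced_class ::
    "'b set \<Rightarrow> 'b bracket \<Rightarrow> 'b set \<Rightarrow> ('b \<Rightarrow> complex) \<Rightarrow>
      (('b list \<Rightarrow>\<^sub>0 complex) set \<times> complex \<Rightarrow>\<^sub>0 int) \<Rightarrow> 'b induced" where
  "induced_class B br B' \<rho> x = induced_kernel B br B' \<rho> #>\<^bsub>induced_pairs B br\<^esub> x"

text \<open>The additive map of the induced module which sends \<open>u \<otimes> c\<close> to \<open>f (u, c)\<close>.\<close>

definition induced_map ::
    "'b set \<Rightarrow> 'b bracket \<Rightarrow> 'b set \<Rightarrow> ('b \<Rightarrow> complex) \<Rightarrow>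
      (('b list \<Rightarrow>\<^sub>0 complex) set \<times> complex \<Rightarrow> ('b list \<Rightarrow>\<^sub>0 complex) set \<times> complex) \<Rightarrow>
      'b induced \<Rightarrow> 'b induced" where
  "induced_map B br B' \<rho> f Z =
     the_elem ((\<lambda>x. induced_class B br B' \<rho> (frag_extend (\<lambda>y. frag_of (f y)) x)) ` Z)"

text \<open>The multiplicative part of the \<open>module\<close> record has no meaning for a module.\<close>

definition induced_module ::
    "'b set \<Rightarrow> 'b bracket \<Rightarrow> 'b set \<Rightarrow> ('b \<Rightarrow> complex) \<Rightarrow> (complex, 'b induced) module" where
  "induced_module B br B' \<rho> =
     (let Q = induced_pairs B br Mod induced_kernel B br B' \<rho> in
      \<lparr>carrier = carrier Q, mult = undefined, one = undefined,
       ring.zero = \<one>\<^bsub>Q\<^esub>, add = monoid.mult Q,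
       smult = (\<lambda>a. induced_map B br B' \<rho> (\<lambda>(u, c). (u, a * c)))\<rparr>)"

definition induced_vacuum :: "'b set \<Rightarrow> 'b bracket \<Rightarrow> 'b set \<Rightarrow> ('b \<Rightarrow> complex) \<Rightarrow> 'b induced" where
  "induced_vacuum B br B' \<rho> = induced_class B br B' \<rho> (frag_of (\<one>\<^bsub>envelope B br\<^esub>, 1))"

definition induced_action ::
    "'b set \<Rightarrow> 'b bracket \<Rightarrow> 'b set \<Rightarrow> ('b \<Rightarrow> complex) \<Rightarrow> ('b \<Rightarrow>\<^sub>0 complex) \<Rightarrow>
      'b induced \<Rightarrow> 'b induced" where
  "induced_action B br B' \<rho> x =
     restrict
       (induced_map B br B' \<rho> (\<lambda>(u, c). (envelope_class B br (to_tensor x) \<otimes>\<^bsub>envelope B br\<^esub> u, c)))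
       (carrier (induced_module B br B' \<rho>))"


section \<open>Central extensions and their Fock modules\<close>

datatype heis_basis = Gen int | Central

definition heis_gen :: "int \<Rightarrow> (heis_basis \<Rightarrow>\<^sub>0 complex)" where
  "heis_gen n = Poly_Mapping.single (Gen n) 1"

text \<open>The bilinear bracket with \<open>[Gen n, Gen m] = \<gamma> n m Central\<close> and \<open>Central\<close> central.\<close>

definition central_bracket :: "(int \<Rightarrow> int \<Rightarrow> complex) \<Rightarrow> heis_basis bracket" where
  "central_bracket \<gamma> x y = Poly_Mapping.single Central
     (\<Sum>n\<in>{n. Gen n \<in> Poly_Mapping.keys x}. \<Sum>m\<in>{m. Gen m \<in> Poly_Mapping.keys y}.
        Poly_Mapping.lookup x (Gen n) * Poly_Mapping.lookup y (Gen m) * \<gamma> n m)"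

definition plus_basis :: "heis_basis set" where
  "plus_basis = insert Central (Gen ` {0..})"

definition fock_char :: "heis_basis \<Rightarrow> complex" where
  "fock_char g = (if g = Central then 1 else 0)"

type_synonym state = "heis_basis induced"

definition fock_module :: "heis_basis bracket \<Rightarrow> (complex, state) module" where
  "fock_module br = induced_module UNIV br plus_basis fock_char"

definition fock_vacuum :: "heis_basis bracket \<Rightarrow> state" where
  "fock_vacuum br = induced_vacuum UNIV br plus_basis fock_char"

definition fock_op :: "heis_basis bracket \<Rightarrow> int \<Rightarrow> state \<Rightarrow> state" where
  "fock_op br n = induced_action UNIV br plus_basis fock_char (heis_gen n)"


section \<open>Operators and formal Laurent series of operators\<close>

definition lin_end :: "(complex, 'v) module \<Rightarrow> ('v \<Rightarrow> 'v) set" where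
  "lin_end V = {f \<in> carrier V \<rightarrow>\<^sub>E carrier V.
     (\<forall>v\<in>carrier V. \<forall>w\<in>carrier V. f (v \<oplus>\<^bsub>V\<^esub> w) = f v \<oplus>\<^bsub>V\<^esub> f w) \<and>
     (\<forall>c. \<forall>v\<in>carrier V. f (c \<odot>\<^bsub>V\<^esub> v) = c \<odot>\<^bsub>V\<^esub> f v)}"

text \<open>Sums with finitely many nonzero terms.\<close>

abbreviation gfinsum :: "(complex, 'v) module \<Rightarrow> ('i \<Rightarrow> 'v) \<Rightarrow> 'i set \<Rightarrow> 'v" where
  "gfinsum V \<equiv> gfinprod (add_monoid V)"

text \<open>\<open>f :: 'v series\<close> stands for \<open>\<Sum>\<^sub>k f k z\<^sup>k\<close>, summed over all integers \<open>k\<close>.\<close>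

type_synonym 'v series = "int \<Rightarrow> 'v \<Rightarrow> 'v"

definition series_one :: "(complex, 'v) module \<Rightarrow> 'v series" where
  "series_one V k = (\<lambda>w\<in>carrier V. if k = 0 then w else \<zero>\<^bsub>V\<^esub>)"

definition series_scale :: "(complex, 'v) module \<Rightarrow> complex \<Rightarrow> 'v series \<Rightarrow> 'v series" where
  "series_scale V c f k = (\<lambda>w\<in>carrier V. c \<odot>\<^bsub>V\<^esub> f k w)"

definition series_add :: "(complex, 'v) module \<Rightarrow> 'v series \<Rightarrow> 'v series \<Rightarrow> 'v series" where
  "series_add V f g k = (\<lambda>w\<in>carrier V. f k w \<oplus>\<^bsub>V\<^esub> g k w)"

definition series_mult :: "(complex, 'v) module \<Rightarrow> 'v series \<Rightarrow> 'v series \<Rightarrow> 'v series" where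
  "series_mult V f g k = (\<lambda>w\<in>carrier V. gfinsum V (\<lambda>i. f i (g (k - i) w)) UNIV)"

definition is_translation ::
    "(complex, 'v) module \<Rightarrow> 'v \<Rightarrow> (int \<Rightarrow> 'v \<Rightarrow> 'v) \<Rightarrow> (int \<Rightarrow> 'v \<Rightarrow> 'v) \<Rightarrow> ('v \<Rightarrow> 'v) \<Rightarrow> bool" where
  "is_translation V vac op com T \<longleftrightarrow>
     T \<in> lin_end V \<and> T vac = \<zero>\<^bsub>V\<^esub> \<and>
     (\<forall>m. \<forall>w\<in>carrier V. T (op m w) \<ominus>\<^bsub>V\<^esub> op m (T w) = com m w)"

text \<open>
  \<open>Y\<close> is the linear map from states to fields which takes the prescribed value \<open>fld [n\<^sub>1,\<dots>,n\<^sub>m]\<close> on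
  the PBW basis vector \<open>op (-n\<^sub>1-1) \<cdots> op (-n\<^sub>m-1) vac\<close>, for all \<open>n\<^sub>1 \<ge> \<dots> \<ge> n\<^sub>m \<ge> 0\<close>.
\<close>

definition is_vertex_map ::
    "(complex, 'v) module \<Rightarrow> 'v \<Rightarrow> (int \<Rightarrow> 'v \<Rightarrow> 'v) \<Rightarrow> (nat list \<Rightarrow> 'v series) \<Rightarrow>
      ('v \<Rightarrow> 'v series) \<Rightarrow> bool" where
  "is_vertex_map V vac op fld Y \<longleftrightarrow>
     Y \<in> carrier V \<rightarrow>\<^sub>E {f. \<forall>k. f k \<in> lin_end V} \<and>
     (\<forall>v\<in>carrier V. \<forall>w\<in>carrier V. Y (v \<oplus>\<^bsub>V\<^esub> w) = series_add V (Y v) (Y w)) \<and>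
     (\<forall>c. \<forall>v\<in>carrier V. Y (c \<odot>\<^bsub>V\<^esub> v) = series_scale V c (Y v)) \<and>
     (\<forall>ns. sorted_wrt (\<ge>) ns \<longrightarrow> Y (foldr (\<lambda>n. op (- int n - 1)) ns vac) = fld ns)"


section \<open>The generalized Heisenberg Krichever-Novikov vertex algebra in genus zero\<close>

text \<open>
  A form \<open>h(z) (dz)\<^sup>\<lambda>\<close> of weight \<open>\<lambda>\<close> on the Riemann sphere is given by its coefficient function
  \<open>h :: complex \<Rightarrow> complex\<close> in the coordinate \<open>z\<close>: functions have weight \<open>0\<close>, 1-forms weight \<open>1\<close>,
  vector fields weight \<open>-1\<close>.
\<close>

definition kn_A :: "int \<Rightarrow> complex \<Rightarrow> complex" where
  "kn_A n z = z powi n"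

definition kn_omega :: "int \<Rightarrow> complex \<Rightarrow> complex" where
  "kn_omega n z = z powi (- n - 1)"

definition kn_e :: "complex \<Rightarrow> complex" where
  "kn_e z = 1"

definition kn_pairing :: "(complex \<Rightarrow> complex) \<Rightarrow> (complex \<Rightarrow> complex) \<Rightarrow> complex \<Rightarrow> complex" where
  "kn_pairing \<alpha> v z = \<alpha> z * v z"

definition kn_d :: "(complex \<Rightarrow> complex) \<Rightarrow> complex \<Rightarrow> complex" where
  "kn_d f = deriv f"

text \<open>The Lie derivative along the constant field \<open>e\<close> differentiates the coefficient, in any weight.\<close>

definition kn_lie :: "(complex \<Rightarrow> complex) \<Rightarrow> complex \<Rightarrow> complex" where
  "kn_lie h = deriv h"

definition kn_Res :: "(complex \<Rightarrow> complex) \<Rightarrow> complex" where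
  "kn_Res \<omega> = residue \<omega> 0"

definition kn_gamma :: "int \<Rightarrow> int \<Rightarrow> complex" where
  "kn_gamma n m = kn_Res (\<lambda>z. kn_A m z * kn_d (kn_A n) z)"

definition kn_xi :: "int \<Rightarrow> int \<Rightarrow> complex" where
  "kn_xi m n = - kn_Res (\<lambda>z. kn_pairing (kn_omega n) kn_e z * kn_d (kn_A m) z)"

definition kn_bracket :: "heis_basis bracket" where
  "kn_bracket = central_bracket kn_gamma"

definition kn_space :: "(complex, state) module" where
  "kn_space = fock_module kn_bracket"

definition kn_vacuum :: state where
  "kn_vacuum = fock_vacuum kn_bracket"

definition kn_op :: "int \<Rightarrow> state \<Rightarrow> state" where
  "kn_op = fock_op kn_bracket"

definition is_kn_translation :: "(state \<Rightarrow> state) \<Rightarrow> bool" where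
  "is_kn_translation = is_translation kn_space kn_vacuum kn_op
     (\<lambda>m w. gfinsum kn_space (\<lambda>n. kn_xi m n \<odot>\<^bsub>kn_space\<^esub> kn_op n w) UNIV)"

definition kn_translation :: "state \<Rightarrow> state" where
  "kn_translation = (THE T. is_kn_translation T)"

text \<open>
  The formal sum \<open>\<Sum>\<^sub>n\<^sub>\<in>\<^sub>N a n \<phi>\<^sub>n(z)\<close> of operators times meromorphic functions, as a Laurent series
  at \<open>z = 0\<close>.
\<close>

definition formal_sum ::
    "(complex, 'v) module \<Rightarrow> int set \<Rightarrow> (int \<Rightarrow> complex \<Rightarrow> complex) \<Rightarrow> (int \<Rightarrow> 'v \<Rightarrow> 'v) \<Rightarrow> 'v series" where
  "formal_sum V N \<phi> a k =
     (\<lambda>w\<in>carrier V. gfinsum V (\<lambda>n. fls_nth (laurent_expansion (\<phi> n) 0) k \<odot>\<^bsub>V\<^esub> a n w) N)"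

abbreviation kn_basis :: "int \<Rightarrow> complex \<Rightarrow> complex" where
  "kn_basis n \<equiv> kn_pairing (kn_omega n) kn_e"

definition kn_current :: "state series" where
  "kn_current = formal_sum kn_space UNIV kn_basis kn_op"

text \<open>The Lie derivative acts on \<open>\<Sum>\<^sub>k f k z\<^sup>k\<close> termwise.\<close>

definition kn_nabla :: "state series \<Rightarrow> state series" where
  "kn_nabla f = formal_sum kn_space UNIV (\<lambda>k. kn_lie (\<lambda>z. z powi k)) f"

text \<open>The modes \<open>a n\<close> of a field written as \<open>a(z) = \<Sum>\<^sub>n a n \<langle>\<omega>\<^sup>n(z), e(z)\<rangle>\<close>.\<close>

definition kn_modes :: "state series \<Rightarrow> int \<Rightarrow> state \<Rightarrow> state" where
  "kn_modes f =
     (THE a. (\<forall>n. a n \<in> lin_end kn_space) \<and> formal_sum kn_space UNIV kn_basis a = f)"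

definition kn_nop :: "state series \<Rightarrow> state series \<Rightarrow> state series" where
  "kn_nop f g = series_add kn_space
     (series_mult kn_space (formal_sum kn_space {..<0} kn_basis (kn_modes f)) g)
     (series_mult kn_space g (formal_sum kn_space {0..} kn_basis (kn_modes f)))"

fun kn_field :: "nat list \<Rightarrow> state series" where
  "kn_field [] = series_one kn_space"
| "kn_field [n] = series_scale kn_space (1 / fact n) ((kn_nabla ^^ n) kn_current)"
| "kn_field (n # n' # ns) = kn_nop (kn_field [n]) (kn_field (n' # ns))"

definition is_kn_vertex_map :: "(state \<Rightarrow> state series) \<Rightarrow> bool" where
  "is_kn_vertex_map = is_vertex_map kn_space kn_vacuum kn_op kn_field"

definition kn_Y :: "state \<Rightarrow> state series" where
  "kn_Y = (THE Y. is_kn_vertex_map Y)"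


section \<open>The Heisenberg vertex algebra\<close>

definition heis_bracket :: "heis_basis bracket" where
  "heis_bracket = central_bracket (\<lambda>n m. if n = - m then of_int n else 0)"

definition heis_space :: "(complex, state) module" where
  "heis_space = fock_module heis_bracket"

definition heis_vacuum :: state where
  "heis_vacuum = fock_vacuum heis_bracket"

definition heis_op :: "int \<Rightarrow> state \<Rightarrow> state" where
  "heis_op = fock_op heis_bracket"

definition is_heis_translation :: "(state \<Rightarrow> state) \<Rightarrow> bool" where
  "is_heis_translation = is_translation heis_space heis_vacuum heis_op
     (\<lambda>m w. of_int (- m) \<odot>\<^bsub>heis_space\<^esub> heis_op (m - 1) w)"

definition heis_translation :: "state \<Rightarrow> state" where
  "heis_translation = (THE T. is_heis_translation T)"

text \<open>Conversion between \<open>\<Sum>\<^sub>n a n z\<^sup>-\<^sup>n\<^sup>-\<^sup>1\<close> and \<open>\<Sum>\<^sub>k f k z\<^sup>k\<close>; the reindexing is an involution.\<close>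

definition of_modes :: "(int \<Rightarrow> 'v \<Rightarrow> 'v) \<Rightarrow> 'v series" where
  "of_modes a k = a (- k - 1)"

definition modes :: "'v series \<Rightarrow> int \<Rightarrow> 'v \<Rightarrow> 'v" where
  "modes f n = f (- n - 1)"

definition heis_current :: "state series" where
  "heis_current = of_modes heis_op"

definition series_deriv :: "(complex, 'v) module \<Rightarrow> 'v series \<Rightarrow> 'v series" where
  "series_deriv V f k = (\<lambda>w\<in>carrier V. of_int (k + 1) \<odot>\<^bsub>V\<^esub> f (k + 1) w)"

definition modes_restrict :: "(complex, 'v) module \<Rightarrow> int set \<Rightarrow> 'v series \<Rightarrow> 'v series" where
  "modes_restrict V N f =
     of_modes (\<lambda>n. if n \<in> N then modes f n else (\<lambda>w\<in>carrier V. \<zero>\<^bsub>V\<^esub>))"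

definition heis_nop :: "state series \<Rightarrow> state series \<Rightarrow> state series" where
  "heis_nop f g = series_add heis_space
     (series_mult heis_space (modes_restrict heis_space {..<0} f) g)
     (series_mult heis_space g (modes_restrict heis_space {0..} f))"

fun nested_nop :: "state series list \<Rightarrow> state series" where
  "nested_nop [] = series_one heis_space"
| "nested_nop [f] = f"
| "nested_nop (f # g # fs) = heis_nop f (nested_nop (g # fs))"

definition heis_field :: "nat list \<Rightarrow> state series" where
  "heis_field ns = series_scale heis_space (1 / (\<Prod>n\<leftarrow>ns. fact n))
     (nested_nop (map (\<lambda>n. (series_deriv heis_space ^^ n) heis_current) ns))"

definition is_heis_vertex_map :: "(state \<Rightarrow> state series) \<Rightarrow> bool" where
  "is_heis_vertex_map = is_vertex_map heis_space heis_vacuum heis_op heis_field"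

definition heis_Y :: "state \<Rightarrow> state series" where
  "heis_Y = (THE Y. is_heis_vertex_map Y)"

end

theory Submission
  imports Defs
begin

text \<open>
  On the sphere, \<open>\<langle>\<omega>\<^sup>n, e\<rangle> = z\<^sup>-\<^sup>n\<^sup>-\<^sup>1\<close>, so the KN expansion of a series is its expansion into modes, and
  \<open>\<nabla>\<close> is termwise differentiation; the residues of \<open>z\<^sup>m d(z\<^sup>n)\<close> give the structure constants. The two
  algebras then agree field by field, up to the scalars \<open>1/n\<^sub>i!\<close>, which are attached to each factor on
  one side and to the whole normal ordered product on the other. Moving them, and recovering the modes
  of a series from its coefficients, uses that the Fock space is a complex module on which
  the generators act linearly, i.e. that the relations of the induced module are respected.
\<close>

subsection \<open>Enveloping algebras and induced modules\<close>

lemma ring_tensor_algebra: "ring (tensor_algebra B)"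
proof (rule ringI)
  show "abelian_group (tensor_algebra B)"
  proof (rule abelian_groupI)
    fix p assume "p \<in> carrier (tensor_algebra B)"
    then show "\<exists>q\<in>carrier (tensor_algebra B). q \<oplus>\<^bsub>tensor_algebra B\<^esub> p = \<zero>\<^bsub>tensor_algebra B\<^esub>"
      by (intro bexI[of _ "- p"]) (auto simp: tensor_algebra_def keys_minus)
  qed (auto simp: tensor_algebra_def algebra_simps dest: subsetD[OF keys_add])
  show "Group.monoid (tensor_algebra B)"
  proof (rule monoidI)
    fix p q assume "p \<in> carrier (tensor_algebra B)" "q \<in> carrier (tensor_algebra B)"
    then show "p \<otimes>\<^bsub>tensor_algebra B\<^esub> q \<in> carrier (tensor_algebra B)"
      using keys_mult[of p q] by (fastforce simp: tensor_algebra_def plus_list_def)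
  qed (auto simp: tensor_algebra_def algebra_simps zero_list_def)
qed (auto simp: tensor_algebra_def algebra_simps)

lemma keys_to_tensor:
  assumes "Poly_Mapping.keys x \<subseteq> B" shows "Poly_Mapping.keys (to_tensor x) \<subseteq> lists B"
proof -
  have "Poly_Mapping.keys (to_tensor x)
      \<subseteq> (\<Union>g\<in>Poly_Mapping.keys x. Poly_Mapping.keys (Poly_Mapping.single [g] (Poly_Mapping.lookup x g)))"
    unfolding to_tensor_def by (rule keys_sum)
  also have "\<dots> \<subseteq> lists B" using assms by auto
  finally show ?thesis .
qed

text \<open>Closure keeps the relators inside the tensor algebra on \<open>B\<close>, so that
  \<open>genideal\<close> really produces an ideal there. It is used both for the whole Lie algebra
  and for the subalgebra.\<close>

definition bracket_closed :: "'b set \<Rightarrow> 'b bracket \<Rightarrow> bool" where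
  "bracket_closed B br \<longleftrightarrow> (\<forall>x y. Poly_Mapping.keys x \<subseteq> B \<longrightarrow> Poly_Mapping.keys y \<subseteq> B \<longrightarrow>
     Poly_Mapping.keys (br x y) \<subseteq> B)"

abbreviation envelope_relations :: "'b set \<Rightarrow> 'b bracket \<Rightarrow> ('b list \<Rightarrow>\<^sub>0 complex) set" where
  "envelope_relations B br \<equiv>
     {to_tensor x * to_tensor y - to_tensor y * to_tensor x - to_tensor (br x y) | x y.
        Poly_Mapping.keys x \<subseteq> B \<and> Poly_Mapping.keys y \<subseteq> B}"

lemma envelope_relations_subset:
  assumes "bracket_closed B br"
  shows "envelope_relations B br \<subseteq> carrier (tensor_algebra B)"
proof clarify
  fix x y :: "'a \<Rightarrow>\<^sub>0 complex" assume xy: "Poly_Mapping.keys x \<subseteq> B" "Poly_Mapping.keys y \<subseteq> B"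
  interpret ring "tensor_algebra B" by (rule ring_tensor_algebra)
  have car: "to_tensor z \<in> carrier (tensor_algebra B)" if "Poly_Mapping.keys z \<subseteq> B" for z
    using keys_to_tensor[OF that] by (simp add: tensor_algebra_def)
  have "Poly_Mapping.keys (br x y) \<subseteq> B" using assms xy by (simp add: bracket_closed_def)
  then have t: "to_tensor x * to_tensor y \<in> carrier (tensor_algebra B)"
    "to_tensor y * to_tensor x \<in> carrier (tensor_algebra B)"
    "to_tensor (br x y) \<in> carrier (tensor_algebra B)"
    using m_closed[OF car car, of x y] m_closed[OF car car, of y x] car xy
    by (simp_all add: tensor_algebra_def)
  have diff: "p - q \<in> carrier (tensor_algebra B)"
    if "p \<in> carrier (tensor_algebra B)" "q \<in> carrier (tensor_algebra B)" for p q
    using that keys_diff[of p q] by (auto simp: tensor_algebra_def)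
  show "to_tensor x * to_tensor y - to_tensor y * to_tensor x - to_tensor (br x y)
      \<in> carrier (tensor_algebra B)"
    by (intro diff t)
qed

lemma ideal_envelope_ideal:
  "bracket_closed B br \<Longrightarrow> ideal (envelope_ideal B br) (tensor_algebra B)"
  unfolding envelope_ideal_def
  by (rule ring.genideal_ideal[OF ring_tensor_algebra]) (rule envelope_relations_subset)

lemma ring_envelope: "bracket_closed B br \<Longrightarrow> ring (envelope B br)"
  unfolding envelope_def by (intro ideal.quotient_is_ring ideal_envelope_ideal)

lemma carrier_envelope:
  "carrier (envelope B br) = envelope_class B br ` carrier (tensor_algebra B)"
  by (auto simp: envelope_def FactRing_def A_RCOSETS_def RCOSETS_def envelope_class_def a_r_coset_def)

text \<open>The larger ideal, cut down to the smaller tensor algebra, is an ideal of the latter and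
  contains its relators; minimality of the generated ideal gives the inclusion. This is what makes
  the map between the envelopes well defined.\<close>

lemma envelope_ideal_mono:
  assumes "B' \<subseteq> B" "bracket_closed B br" "bracket_closed B' br"
  shows "envelope_ideal B' br \<subseteq> envelope_ideal B br"
proof -
  interpret T: ring "tensor_algebra B" by (rule ring_tensor_algebra)
  interpret T': ring "tensor_algebra B'" by (rule ring_tensor_algebra)
  interpret I: ideal "envelope_ideal B br" "tensor_algebra B"
    by (rule ideal_envelope_ideal) fact
  have sub: "carrier (tensor_algebra B') \<subseteq> carrier (tensor_algebra B)"
    using lists_mono[OF assms(1)] by (auto simp: tensor_algebra_def)
  let ?J = "envelope_ideal B br \<inter> carrier (tensor_algebra B')"
  have "ideal ?J (tensor_algebra B')"
  proof (rule idealI[OF ring_tensor_algebra])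
    show "subgroup ?J (add_monoid (tensor_algebra B'))"
    proof (rule group.subgroupI[OF T'.a_group])
      show "?J \<noteq> {}" using I.zero_closed T'.zero_closed by (auto simp: tensor_algebra_def)
    next
      fix p assume p: "p \<in> ?J"
      \<comment> \<open>The additive inverse of a ring record refers to its carrier, so the inverses
        in the two tensor algebras are compared through the common value \<open>- p\<close>.\<close>
      have "\<ominus>\<^bsub>tensor_algebra B\<^esub> p = - p" if "p \<in> carrier (tensor_algebra B)" for p B
        using that ring.is_abelian_group[OF ring_tensor_algebra, of B]
        by (intro abelian_group.minus_equality) (auto simp: tensor_algebra_def keys_minus)
      then have eq: "\<ominus>\<^bsub>tensor_algebra B'\<^esub> p = \<ominus>\<^bsub>tensor_algebra B\<^esub> p"
        using p sub by (metis IntD2 subsetD)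
      have "\<ominus>\<^bsub>tensor_algebra B\<^esub> p \<in> envelope_ideal B br" using p by simp
      moreover have "\<ominus>\<^bsub>tensor_algebra B'\<^esub> p \<in> carrier (tensor_algebra B')" using p by simp
      ultimately show "inv\<^bsub>add_monoid (tensor_algebra B')\<^esub> p \<in> ?J"
        using eq by (auto simp: a_inv_def)
    next
      fix p q assume pq: "p \<in> ?J" "q \<in> ?J"
      then have "p \<oplus>\<^bsub>tensor_algebra B\<^esub> q \<in> envelope_ideal B br"
        "p \<oplus>\<^bsub>tensor_algebra B'\<^esub> q \<in> carrier (tensor_algebra B')" by simp_all
      then show "p \<otimes>\<^bsub>add_monoid (tensor_algebra B')\<^esub> q \<in> ?J"
        by (simp add: tensor_algebra_def)
    qed auto
  next
    fix p q assume pq: "p \<in> ?J" "q \<in> carrier (tensor_algebra B')"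
    then have "q \<in> carrier (tensor_algebra B)" using sub by blast
    then have "q * p \<in> envelope_ideal B br" "p * q \<in> envelope_ideal B br"
      using pq I.I_l_closed[of p q] I.I_r_closed[of p q] by (simp_all add: tensor_algebra_def)
    moreover have "q \<otimes>\<^bsub>tensor_algebra B'\<^esub> p \<in> carrier (tensor_algebra B')"
      "p \<otimes>\<^bsub>tensor_algebra B'\<^esub> q \<in> carrier (tensor_algebra B')"
      using pq by simp_all
    ultimately show "q \<otimes>\<^bsub>tensor_algebra B'\<^esub> p \<in> ?J" "p \<otimes>\<^bsub>tensor_algebra B'\<^esub> q \<in> ?J"
      by (simp_all add: tensor_algebra_def)
  qed
  moreover have "envelope_relations B' br \<subseteq> ?J"
  proof -
    have "envelope_relations B' br \<subseteq> envelope_relations B br" using assms(1) by blast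
    also have "\<dots> \<subseteq> envelope_ideal B br"
      unfolding envelope_ideal_def
      by (rule T.genideal_self) (rule envelope_relations_subset, fact)
    finally show ?thesis using envelope_relations_subset[OF assms(3)] by blast
  qed
  ultimately show ?thesis
    unfolding envelope_ideal_def[of B'] using T'.genideal_minimal by blast
qed

text \<open>By \<open>envelope_ideal_mono\<close> all representatives of a class of the subalgebra
  have the same class in the envelope of \<open>B\<close>. The image under \<open>the_elem\<close>
  is therefore a singleton.\<close>

lemma envelope_incl_closed:
  assumes "B' \<subseteq> B" "bracket_closed B br" "bracket_closed B' br" "s \<in> carrier (envelope B' br)"
  shows "envelope_incl B br s \<in> carrier (envelope B br)"
proof -
  interpret I: ideal "envelope_ideal B br" "tensor_algebra B"
    by (rule ideal_envelope_ideal) fact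
  interpret I': ideal "envelope_ideal B' br" "tensor_algebra B'"
    by (rule ideal_envelope_ideal) fact
  obtain p where p: "p \<in> carrier (tensor_algebra B')" and s: "s = envelope_class B' br p"
    using assms(4) by (auto simp: carrier_envelope)
  have pB: "p \<in> carrier (tensor_algebra B)"
    using p lists_mono[OF assms(1)] by (auto simp: tensor_algebra_def)
  have "envelope_class B br q = envelope_class B br p" if q: "q \<in> s" for q
  proof -
    obtain i where "i \<in> envelope_ideal B' br" "q = i + p"
      using q by (auto simp: s envelope_class_def a_r_coset_def r_coset_def tensor_algebra_def)
    then have "q \<in> envelope_class B br p"
      using envelope_ideal_mono[OF assms(1-3)]
      by (auto simp: envelope_class_def a_r_coset_def r_coset_def tensor_algebra_def)
    then show ?thesis
      using I.a_repr_independence[OF _ pB I.is_additive_subgroup[THEN additive_subgroup.a_subgroup]]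
      by (simp add: envelope_class_def)
  qed
  moreover have "p \<in> s"
    using I'.a_rcos_self[OF p] by (simp add: s envelope_class_def)
  ultimately have "envelope_class B br ` s = {envelope_class B br p}" by blast
  then show ?thesis using pB by (auto simp: envelope_incl_def carrier_envelope)
qed

text \<open>The complex numbers as a ring record, so that the library theory of modules over a
  commutative ring applies to the induced module.\<close>

definition complex_ring :: "complex ring" where
  "complex_ring = \<lparr>carrier = UNIV, mult = (*), one = 1, ring.zero = 0, add = (+)\<rparr>"

lemma complex_ring_simps [simp]:
  "carrier complex_ring = UNIV" "a \<otimes>\<^bsub>complex_ring\<^esub> b = a * b" "a \<oplus>\<^bsub>complex_ring\<^esub> b = a + b"
  "\<one>\<^bsub>complex_ring\<^esub> = 1" "\<zero>\<^bsub>complex_ring\<^esub> = 0"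
  by (simp_all add: complex_ring_def)

lemma cring_complex_ring: "cring complex_ring"
proof (intro cringI abelian_groupI comm_monoidI)
  fix x :: complex
  show "\<exists>y\<in>carrier complex_ring. y \<oplus>\<^bsub>complex_ring\<^esub> x = \<zero>\<^bsub>complex_ring\<^esub>"
    by (rule bexI[of _ "- x"]) simp_all
qed (simp_all add: algebra_simps)

section \<open>The tensor product as a quotient of the free abelian group on pairs\<close>

locale induced_from_subalgebra =
  fixes B :: "'b set" and br :: "'b bracket" and B' :: "'b set" and \<rho> :: "'b \<Rightarrow> complex"
  assumes subalgebra: "B' \<subseteq> B"
    and closed: "bracket_closed B br" and closed': "bracket_closed B' br"
begin

abbreviation "U \<equiv> envelope B br"
abbreviation "F \<equiv> induced_pairs B br"
abbreviation "K \<equiv> induced_kernel B br B' \<rho>"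
abbreviation "cls \<equiv> induced_class B br B' \<rho>"
abbreviation "V \<equiv> induced_module B br B' \<rho>"
abbreviation "rels \<equiv> tensor_relations (carrier (envelope B' br)) U
        (\<lambda>u s. u \<otimes>\<^bsub>U\<^esub> envelope_incl B br s) (\<lambda>s c. envelope_char \<rho> s * c)"
abbreviation ext :: "(('b list \<Rightarrow>\<^sub>0 complex) set \<times> complex \<Rightarrow> ('b list \<Rightarrow>\<^sub>0 complex) set \<times> complex) \<Rightarrow>
    (('b list \<Rightarrow>\<^sub>0 complex) set \<times> complex \<Rightarrow>\<^sub>0 int) \<Rightarrow> (('b list \<Rightarrow>\<^sub>0 complex) set \<times> complex \<Rightarrow>\<^sub>0 int)"
  where "ext f \<equiv> frag_extend (\<lambda>y. frag_of (f y))"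

sublocale U: ring U by (rule ring_envelope) (rule closed)

sublocale F: comm_group F unfolding induced_pairs_def by (rule abelian_free_Abelian_group)

lemma F_simps [simp]:
  "x \<otimes>\<^bsub>F\<^esub> y = x + y" "\<one>\<^bsub>F\<^esub> = 0" "frag_of (u, c) \<in> carrier F \<longleftrightarrow> u \<in> carrier U"
  by (auto simp: induced_pairs_def)

lemma F_inv: "x \<in> carrier F \<Longrightarrow> inv\<^bsub>F\<^esub> x = - x"
  by (simp add: induced_pairs_def)

lemma F_diff: "x \<in> carrier F \<Longrightarrow> y \<in> carrier F \<Longrightarrow> x - y \<in> carrier F"
  using F.m_closed[OF _ F.inv_closed, of x y] by (simp add: F_inv)

lemma incl_closed: "s \<in> carrier (envelope B' br) \<Longrightarrow> envelope_incl B br s \<in> carrier U"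
  by (rule envelope_incl_closed[OF subalgebra closed closed'])

lemma rels_subset: "rels \<subseteq> carrier F"
  unfolding tensor_relations_def by (auto intro!: F_diff incl_closed)

lemma K_subgroup: "subgroup K F"
  unfolding induced_kernel_def by (rule F.generate_is_subgroup[OF rels_subset])

lemma K_normal: "K \<lhd> F"
  using K_subgroup by (rule F.subgroup_imp_normal)

lemma rels_in_K: "x \<in> rels \<Longrightarrow> x \<in> K"
  unfolding induced_kernel_def by (rule generate.incl)

lemma K_diff: "x \<in> K \<Longrightarrow> y \<in> K \<Longrightarrow> x - y \<in> K"
  using subgroup.m_closed[OF K_subgroup] subgroup.m_inv_closed[OF K_subgroup]
    subgroup.mem_carrier[OF K_subgroup] F_inv by (metis F_simps(1) add_uminus_conv_diff)

lemma K_zero: "0 \<in> K"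
  using subgroup.one_closed[OF K_subgroup] by simp

lemma cls_eqI:
  assumes "y - x \<in> K" "x \<in> carrier F" shows "cls y = cls x"
proof -
  have "y \<in> K #>\<^bsub>F\<^esub> x" using assms(1) by (force simp: r_coset_def)
  then show ?thesis
    unfolding induced_class_def using F.repr_independence assms(2) K_subgroup by blast
qed

lemma V_carrier: "carrier V = cls ` carrier F"
  by (auto simp: induced_module_def Let_def FactGroup_def RCOSETS_def induced_class_def)

lemma V_add: "x \<in> carrier F \<Longrightarrow> y \<in> carrier F \<Longrightarrow> cls x \<oplus>\<^bsub>V\<^esub> cls y = cls (x + y)"
  using normal.rcos_sum[OF K_normal, of x y]
  by (simp add: induced_module_def Let_def FactGroup_def induced_class_def)

lemma abelian_group_V: "abelian_group V"
proof -
  interpret Q: comm_group "F Mod K" by (rule F.abelian_FactGroup) (rule K_subgroup)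
  have V: "carrier V = carrier (F Mod K)" "v \<oplus>\<^bsub>V\<^esub> w = v \<otimes>\<^bsub>F Mod K\<^esub> w" "\<zero>\<^bsub>V\<^esub> = \<one>\<^bsub>F Mod K\<^esub>" for v w
    by (simp_all add: induced_module_def Let_def)
  show ?thesis
    by (rule abelian_groupI; unfold V)
      (rule Q.m_closed Q.one_closed Q.m_assoc Q.m_comm Q.l_one Q.l_inv_ex; assumption)+
qed

lemma ext_closed:
  assumes "\<And>u c. u \<in> carrier U \<Longrightarrow> fst (f (u, c)) \<in> carrier U" "x \<in> carrier F"
  shows "ext f x \<in> carrier F"
proof -
  have "f y \<in> carrier U \<times> UNIV" if "y \<in> Poly_Mapping.keys x" for y
  proof -
    have "fst y \<in> carrier U" using assms(2) that by (auto simp: induced_pairs_def)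
    then show ?thesis using assms(1)[of "fst y" "snd y"] by (simp add: mem_Times_iff)
  qed
  moreover have "Poly_Mapping.keys (ext f x) \<subseteq> f ` Poly_Mapping.keys x"
    using keys_frag_extend[of "\<lambda>y. frag_of (f y)" x] by auto
  ultimately have "Poly_Mapping.keys (ext f x) \<subseteq> carrier U \<times> UNIV" by blast
  then show ?thesis by (simp add: induced_pairs_def)
qed

text \<open>A condition under which \<open>induced_map\<close> is well defined on cosets. Since
  \<open>ext f\<close> is additive, it only has to be tested on the generating relations.\<close>

definition descends :: "(('b list \<Rightarrow>\<^sub>0 complex) set \<times> complex \<Rightarrow> ('b list \<Rightarrow>\<^sub>0 complex) set \<times> complex) \<Rightarrow> bool"
  where "descends f \<longleftrightarrow> (\<forall>u c. u \<in> carrier U \<longrightarrow> fst (f (u, c)) \<in> carrier U) \<and> ext f ` rels \<subseteq> K"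

lemma descends_closed: "descends f \<Longrightarrow> x \<in> carrier F \<Longrightarrow> ext f x \<in> carrier F"
  by (rule ext_closed) (auto simp: descends_def)

text \<open>Additivity of \<open>ext f\<close> carries the condition from the relations to the
  subgroup they generate, by induction over its generation.\<close>

lemma ext_K:
  assumes "descends f" "x \<in> K" shows "ext f x \<in> K"
  using assms(2) unfolding induced_kernel_def
proof (induction rule: generate.induct)
  case one
  then show ?case using K_zero by (simp add: induced_kernel_def)
next
  case (incl h)
  then show ?case using assms(1) by (auto simp: descends_def induced_kernel_def)
next
  case (inv h)
  then have "ext f h \<in> K" "h \<in> carrier F"
    using assms(1) rels_subset by (auto simp: descends_def)
  then have "- ext f h \<in> K" using K_diff[OF K_zero] by force
  then show ?case
    using F_inv[OF \<open>h \<in> carrier F\<close>] by (simp add: induced_kernel_def frag_extend_minus)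
next
  case (eng h1 h2)
  then show ?case
    using subgroup.m_closed[OF K_subgroup] by (simp add: induced_kernel_def frag_extend_add)
qed

text \<open>Two representatives differ by an element of \<open>K\<close>, which \<open>ext f\<close>
  keeps in \<open>K\<close>. Hence \<open>the_elem\<close> is applied to a singleton, and maps on
  the quotient can be computed on representatives.\<close>

lemma induced_map_cls:
  assumes f: "descends f" and x: "x \<in> carrier F"
  shows "induced_map B br B' \<rho> f (cls x) = cls (ext f x)"
proof -
  have "cls (ext f y) = cls (ext f x)" if y: "y \<in> cls x" for y
  proof (rule cls_eqI)
    obtain k where k: "k \<in> K" "y = k + x"
      using y by (auto simp: induced_class_def r_coset_def)
    then show "ext f y - ext f x \<in> K" using ext_K[OF f] by (simp add: frag_extend_add)
  qed (rule descends_closed[OF f x])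
  moreover have "x \<in> cls x"
    unfolding induced_class_def using F.rcos_self[OF x K_subgroup] .
  ultimately have "(\<lambda>y. cls (ext f y)) ` cls x = {cls (ext f x)}" by blast
  then show ?thesis by (simp add: induced_map_def)
qed

lemma biadditive_K:
  assumes "m \<in> carrier U"
  shows "m' \<in> carrier U \<Longrightarrow> frag_of (m \<oplus>\<^bsub>U\<^esub> m', n) - frag_of (m, n) - frag_of (m', n) \<in> K"
    and "frag_of (m, n + n') - frag_of (m, n) - frag_of (m, n') \<in> K"
    and "s \<in> carrier (envelope B' br) \<Longrightarrow>
      frag_of (m \<otimes>\<^bsub>U\<^esub> envelope_incl B br s, n) - frag_of (m, envelope_char \<rho> s * n) \<in> K"
  by (rule rels_in_K, use assms in \<open>unfold tensor_relations_def, blast\<close>)+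

text \<open>Scaling commutes with the action of the character because complex multiplication is
  commutative, so the balancing relation at \<open>n\<close> goes to the one at
  \<open>a * n\<close>.\<close>

lemma descends_scale: "descends (\<lambda>(u, c). (u, a * c))"
proof -
  have "frag_of (m \<otimes>\<^bsub>U\<^esub> envelope_incl B br s, a * n) - frag_of (m, a * (envelope_char \<rho> s * n)) \<in> K"
    if "m \<in> carrier U" "s \<in> carrier (envelope B' br)" for m s n
    using biadditive_K(3)[OF that, of "a * n"] by (simp add: mult.left_commute)
  then show ?thesis
    unfolding descends_def tensor_relations_def
    by (auto simp: frag_extend_diff distrib_left biadditive_K)
qed

text \<open>Left multiplication commutes with the right action of the subalgebra by associativity
  and is additive by distributivity, so each relation is sent to a relation of the same
  kind.\<close>

lemma descends_mult:
  "a \<in> carrier U \<Longrightarrow> descends (\<lambda>(u, c). (a \<otimes>\<^bsub>U\<^esub> u, c))"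
  unfolding descends_def tensor_relations_def
  by (auto simp: frag_extend_diff U.r_distr incl_closed biadditive_K simp flip: U.m_assoc)

lemma induced_map_add:
  assumes "descends f" "v \<in> carrier V" "w \<in> carrier V"
  shows "induced_map B br B' \<rho> f (v \<oplus>\<^bsub>V\<^esub> w) = induced_map B br B' \<rho> f v \<oplus>\<^bsub>V\<^esub> induced_map B br B' \<rho> f w"
proof -
  obtain x y where "x \<in> carrier F" "y \<in> carrier F" "v = cls x" "w = cls y"
    using assms by (auto simp: V_carrier)
  moreover from this have "x + y \<in> carrier F" using F.m_closed[of x y] by simp
  ultimately show ?thesis
    using assms(1) by (simp add: V_add induced_map_cls descends_closed frag_extend_add)
qed

lemma induced_map_closed:
  "descends f \<Longrightarrow> v \<in> carrier V \<Longrightarrow> induced_map B br B' \<rho> f v \<in> carrier V"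
  by (auto simp: V_carrier induced_map_cls descends_closed)

lemma ext_ext: "ext f (ext g x) = ext (f \<circ> g) x"
  using frag_extend_compose[of "\<lambda>y. frag_of (f y)" g x] by (simp add: o_def)

lemma induced_map_induced_map:
  assumes "descends f" "descends g" "descends (f \<circ> g)" "v \<in> carrier V"
  shows "induced_map B br B' \<rho> f (induced_map B br B' \<rho> g v) = induced_map B br B' \<rho> (f \<circ> g) v"
proof -
  obtain x where "x \<in> carrier F" "v = cls x" using assms by (auto simp: V_carrier)
  then show ?thesis
    using assms by (simp add: induced_map_cls descends_closed ext_ext del: o_apply)
qed

section \<open>Complex structure of the induced module and linearity of the action\<close>

lemma V_smult: "a \<odot>\<^bsub>V\<^esub> v = induced_map B br B' \<rho> (\<lambda>(u, c). (u, a * c)) v"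
  by (simp add: induced_module_def Let_def)

lemma module_V: "Module.module complex_ring V"
proof (rule moduleI[OF cring_complex_ring abelian_group_V])
  fix a b :: complex and v w assume v: "v \<in> carrier V"
  show "a \<odot>\<^bsub>V\<^esub> v \<in> carrier V"
    using v by (simp add: V_smult induced_map_closed descends_scale)
  show "a \<odot>\<^bsub>V\<^esub> (v \<oplus>\<^bsub>V\<^esub> w) = a \<odot>\<^bsub>V\<^esub> v \<oplus>\<^bsub>V\<^esub> a \<odot>\<^bsub>V\<^esub> w" if "w \<in> carrier V"
    using v that by (simp add: V_smult induced_map_add descends_scale)
  have comp: "(\<lambda>(u, c). (u, a * c)) \<circ> (\<lambda>(u, c). (u, b * c)) = (\<lambda>(u, c). (u, a * b * c))"
    by (auto simp: fun_eq_iff)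
  show "(a \<otimes>\<^bsub>complex_ring\<^esub> b) \<odot>\<^bsub>V\<^esub> v = a \<odot>\<^bsub>V\<^esub> (b \<odot>\<^bsub>V\<^esub> v)"
    using v induced_map_induced_map[OF descends_scale descends_scale _ v, of a b]
    by (simp add: V_smult comp descends_scale)
  obtain x where x: "x \<in> carrier F" "v = cls x" using v by (auto simp: V_carrier)
  have "ext (\<lambda>(u, c). (u, c)) x = x" using frag_expansion[of x] by (simp add: case_prod_beta)
  then show "\<one>\<^bsub>complex_ring\<^esub> \<odot>\<^bsub>V\<^esub> v = v"
    using x induced_map_cls[OF descends_scale[of 1]] by (simp add: V_smult)
  let ?s = "\<lambda>a. ext (\<lambda>(u, c). (u, a * c))"
  have "Poly_Mapping.keys x \<subseteq> carrier U \<times> UNIV" using x by (simp add: induced_pairs_def)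
  \<comment> \<open>Additivity in the scalar holds only modulo \<open>K\<close>: on a generator the
    difference is a relation of additivity in the second tensor factor. Induction over differences
    of generators does the rest.\<close>
  then have "?s (a + b) x - (?s a x + ?s b x) \<in> K"
  proof (induction x rule: frag_induction)
    case zero
    then show ?case by (simp add: K_zero)
  next
    case (one y)
    then obtain u c where "y = (u, c)" "u \<in> carrier U" by auto
    then show ?case
      by (intro rels_in_K) (auto simp: tensor_relations_def distrib_right diff_diff_eq)
  next
    case (diff x y)
    then show ?case
      using K_diff[OF diff] by (simp add: frag_extend_diff algebra_simps)
  qed
  moreover have "?s a x + ?s b x \<in> carrier F"
    using F.m_closed[OF descends_closed[OF descends_scale x(1)] descends_closed[OF descends_scale x(1)]]
    by simp
  ultimately have "cls (?s (a + b) x) = cls (?s a x + ?s b x)" by (rule cls_eqI)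
  then show "(a \<oplus>\<^bsub>complex_ring\<^esub> b) \<odot>\<^bsub>V\<^esub> v = a \<odot>\<^bsub>V\<^esub> v \<oplus>\<^bsub>V\<^esub> b \<odot>\<^bsub>V\<^esub> v"
    using x by (simp add: V_smult induced_map_cls descends_scale V_add descends_closed)
qed

text \<open>Left multiplication changes the first tensor factor and scaling the second, so the two
  commute already on pairs. The restriction in \<open>induced_action\<close> supplies the
  extensionality that \<open>lin_end\<close> demands.\<close>

lemma action_lin_end:
  assumes "Poly_Mapping.keys x \<subseteq> B"
  shows "induced_action B br B' \<rho> x \<in> lin_end V"
proof -
  let ?a = "envelope_class B br (to_tensor x)"
  have a: "?a \<in> carrier U"
    using keys_to_tensor[OF assms] by (auto simp: carrier_envelope tensor_algebra_def)
  let ?f = "\<lambda>(u, c). (?a \<otimes>\<^bsub>U\<^esub> u, c)"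
  note f = descends_mult[OF a]
  interpret Module.module complex_ring V by (rule module_V)
  have "induced_map B br B' \<rho> ?f (c \<odot>\<^bsub>V\<^esub> v) = c \<odot>\<^bsub>V\<^esub> induced_map B br B' \<rho> ?f v"
    if v: "v \<in> carrier V" for c v
  proof -
    let ?g = "\<lambda>(u, d). (u, c * d)"
    have eq: "?f \<circ> ?g = ?g \<circ> ?f" by (auto simp: fun_eq_iff)
    obtain y where y: "y \<in> carrier F" "v = cls y" using v by (auto simp: V_carrier)
    have "ext ?f (ext ?g y) = ext ?g (ext ?f y)"
      by (simp only: ext_ext eq)
    then show ?thesis
      using y f by (simp add: V_smult induced_map_cls descends_scale descends_closed)
  qed
  moreover have "v \<oplus>\<^bsub>V\<^esub> w \<in> carrier V" "c \<odot>\<^bsub>V\<^esub> v \<in> carrier V"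
    if "v \<in> carrier V" "w \<in> carrier V" for v w c
    using that smult_closed[of c v] by auto
  ultimately show ?thesis
    using f by (auto simp: lin_end_def induced_action_def induced_map_add induced_map_closed)
qed

end

subsection \<open>Series of operators\<close>

text \<open>Weaker than linearity on purpose. A sum of infinite support counts as zero, so a product
  of arbitrary series with linear coefficients may fail to be additive, but it stays compatible with
  scalars.\<close>

definition homogeneous :: "(complex, 'v) module \<Rightarrow> 'v series \<Rightarrow> bool" where
  "homogeneous V f \<longleftrightarrow> (\<forall>k. \<forall>w\<in>carrier V. f k w \<in> carrier V \<and>
     (\<forall>c. f k (c \<odot>\<^bsub>V\<^esub> w) = c \<odot>\<^bsub>V\<^esub> f k w))"

text \<open>The common form of both normal ordered products, over a general space so that its
  behaviour under scalars can be proved from the module axioms.\<close>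

definition series_nop :: "(complex, 'v) module \<Rightarrow> 'v series \<Rightarrow> 'v series \<Rightarrow> 'v series" where
  "series_nop V f g = series_add V
     (series_mult V (modes_restrict V {..<0} f) g)
     (series_mult V g (modes_restrict V {0..} f))"

lemma heis_nop_eq: "heis_nop = series_nop heis_space"
  by (simp add: fun_eq_iff heis_nop_def series_nop_def)

locale complex_space = Module.module complex_ring V for V :: "(complex, 'v) module"
begin

lemmas smult_mem [simp] = smult_closed[simplified]
lemmas smult_zero_left [simp] = smult_l_null[simplified]
lemmas smult_zero_right [simp] = smult_r_null[simplified]
lemmas smult_unit [simp] = smult_one[simplified]
lemmas smult_smult = smult_assoc1[simplified, symmetric]
lemmas smult_add = smult_r_distr[simplified]

lemma gfinsum_closed:
  "(\<And>i. i \<in> A \<Longrightarrow> f i \<in> carrier V) \<Longrightarrow> gfinsum V f A \<in> carrier V"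
  using comm_monoid.gfinprod_closed[OF M.a_comm_monoid, of f A] by auto

text \<open>In genus zero the sums over KN basis elements in the current, in the Lie derivative and
  in the translation rule have at most one nonzero term; this lemma collapses them.\<close>

lemma gfinsum_single:
  assumes "\<And>i. i \<in> A \<Longrightarrow> i \<noteq> j \<Longrightarrow> f i = \<zero>\<^bsub>V\<^esub>" "f j \<in> carrier V"
  shows "gfinsum V f A = (if j \<in> A then f j else \<zero>\<^bsub>V\<^esub>)"
proof -
  interpret add: comm_monoid "add_monoid V" by (rule M.a_comm_monoid)
  have "f i \<in> carrier V" if "i \<in> A" for i
    using assms that by (cases "i = j") auto
  then have "gfinsum V f A = gfinsum V f (A \<inter> {j})"
    using assms by (intro add.gfinprod_mono_neutral_cong_right) auto
  also have "\<dots> = (if j \<in> A then f j else \<zero>\<^bsub>V\<^esub>)"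
    using assms(2) by (auto simp: Int_absorb1 finprod_singleton)
  finally show ?thesis .
qed

text \<open>
  No finiteness is assumed: a sum with infinitely many nonzero terms is \<open>0\<close> by convention,
  and multiplication by a nonzero scalar preserves the support. This is why scalars can be pulled
  out of normal ordered products without checking that the factors are fields.
\<close>

lemma gfinsum_smult:
  assumes "\<And>i. i \<in> A \<Longrightarrow> f i \<in> carrier V"
  shows "gfinsum V (\<lambda>i. c \<odot>\<^bsub>V\<^esub> f i) A = c \<odot>\<^bsub>V\<^esub> gfinsum V f A"
proof (cases "c = 0")
  case True
  \<comment> \<open>For \<open>c = 0\<close> the support may drop from infinite to empty, so the
    case is separate: both sides vanish. The index \<open>undefined\<close> is arbitrary, as every
    term is zero.\<close>
  then show ?thesis
    using assms by (simp add: gfinsum_closed gfinsum_single[of A undefined "\<lambda>_. \<zero>\<^bsub>V\<^esub>", simplified]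
        cong: comm_monoid.gfinprod_cong[OF M.a_comm_monoid])
next
  case False
  have "c \<odot>\<^bsub>V\<^esub> v = \<zero>\<^bsub>V\<^esub> \<longleftrightarrow> v = \<zero>\<^bsub>V\<^esub>" if "v \<in> carrier V" for v
  proof
    assume "c \<odot>\<^bsub>V\<^esub> v = \<zero>\<^bsub>V\<^esub>"
    then have "(1 / c) \<odot>\<^bsub>V\<^esub> (c \<odot>\<^bsub>V\<^esub> v) = \<zero>\<^bsub>V\<^esub>" by simp
    then show "v = \<zero>\<^bsub>V\<^esub>" using False that by (simp add: smult_smult)
  qed simp
  then have supp: "{i \<in> A. c \<odot>\<^bsub>V\<^esub> f i \<noteq> \<zero>\<^bsub>V\<^esub>} = {i \<in> A. f i \<noteq> \<zero>\<^bsub>V\<^esub>}"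
    using assms by auto
  show ?thesis
  proof (cases "finite {i \<in> A. f i \<noteq> \<zero>\<^bsub>V\<^esub>}")
    case True
    then have "c \<odot>\<^bsub>V\<^esub> finsum V f {i \<in> A. f i \<noteq> \<zero>\<^bsub>V\<^esub>}
        = finsum V (\<lambda>i. c \<odot>\<^bsub>V\<^esub> f i) {i \<in> A. f i \<noteq> \<zero>\<^bsub>V\<^esub>}"
      using assms by (intro finsum_smult_ldistr) auto
    then show ?thesis using True by (simp add: gfinprod_def supp finsum_def)
  qed (simp add: gfinprod_def supp)
qed

lemma lin_endD:
  assumes "f \<in> lin_end V" "w \<in> carrier V"
  shows "f w \<in> carrier V" "f (c \<odot>\<^bsub>V\<^esub> w) = c \<odot>\<^bsub>V\<^esub> f w"
  using assms by (auto simp: lin_end_def)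

lemma lin_end_restrict: "f \<in> lin_end V \<Longrightarrow> (\<lambda>w\<in>carrier V. f w) = f"
  by (auto simp: lin_end_def fun_eq_iff PiE_def extensional_def)

lemma lin_end_scale:
  assumes "f \<in> lin_end V" shows "(\<lambda>w\<in>carrier V. c \<odot>\<^bsub>V\<^esub> f w) \<in> lin_end V"
  using assms by (auto simp: lin_end_def smult_add smult_smult mult.commute Pi_iff PiE_def)

section \<open>Scalars in products of series\<close>

lemma homogeneous_lin_end: "(\<And>k. f k \<in> lin_end V) \<Longrightarrow> homogeneous V f"
  by (simp add: homogeneous_def lin_endD)

lemma homogeneous_mult:
  assumes "homogeneous V f" "homogeneous V g"
  shows "homogeneous V (series_mult V f g)"
  using assms by (simp add: homogeneous_def series_mult_def gfinsum_closed gfinsum_smult)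

lemma homogeneous_add:
  "homogeneous V f \<Longrightarrow> homogeneous V g \<Longrightarrow> homogeneous V (series_add V f g)"
  by (simp add: homogeneous_def series_add_def smult_add)

lemma homogeneous_modes_restrict:
  "homogeneous V f \<Longrightarrow> homogeneous V (modes_restrict V N f)"
  by (simp add: homogeneous_def modes_restrict_def of_modes_def modes_def)

lemma homogeneous_nop:
  "homogeneous V f \<Longrightarrow> homogeneous V g \<Longrightarrow> homogeneous V (series_nop V f g)"
  by (simp add: series_nop_def homogeneous_add homogeneous_mult homogeneous_modes_restrict)

lemma series_mult_scale:
  assumes "homogeneous V f" "homogeneous V g"
  shows "series_mult V (series_scale V c f) (series_scale V d g)
    = series_scale V (c * d) (series_mult V f g)"
proof (intro ext)
  fix k w
  show "series_mult V (series_scale V c f) (series_scale V d g) k w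
      = series_scale V (c * d) (series_mult V f g) k w"
  proof (cases "w \<in> carrier V")
    case True
    have "series_mult V (series_scale V c f) (series_scale V d g) k w
        = gfinsum V (\<lambda>i. series_scale V c f i (series_scale V d g (k - i) w)) UNIV"
      using True by (simp add: series_mult_def)
    also have "\<dots> = gfinsum V (\<lambda>i. (c * d) \<odot>\<^bsub>V\<^esub> f i (g (k - i) w)) UNIV"
      using assms True by (simp add: series_scale_def homogeneous_def smult_smult)
    also have "\<dots> = (c * d) \<odot>\<^bsub>V\<^esub> gfinsum V (\<lambda>i. f i (g (k - i) w)) UNIV"
      using assms True by (intro gfinsum_smult) (simp add: homogeneous_def)
    finally show ?thesis using True by (simp add: series_scale_def series_mult_def)
  qed (simp add: series_scale_def series_mult_def)
qed

lemma series_add_scale: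
  assumes "homogeneous V f" "homogeneous V g"
  shows "series_add V (series_scale V c f) (series_scale V c g) = series_scale V c (series_add V f g)"
  using assms by (auto simp: fun_eq_iff series_add_def series_scale_def homogeneous_def smult_add)

lemma modes_restrict_scale:
  "modes_restrict V N (series_scale V c f) = series_scale V c (modes_restrict V N f)"
  by (auto simp: fun_eq_iff modes_restrict_def of_modes_def modes_def series_scale_def)

text \<open>Splitting into modes commutes with scaling, and both summands acquire the same scalar
  although their factors stand in opposite order. This collects the \<open>1/n!\<close> of the
  factors in front of a nested product.\<close>

lemma series_nop_scale:
  assumes "homogeneous V f" "homogeneous V g"
  shows "series_nop V (series_scale V c f) (series_scale V d g)
    = series_scale V (c * d) (series_nop V f g)"
  using assms
  by (simp add: series_nop_def modes_restrict_scale series_mult_scale series_add_scale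
      homogeneous_modes_restrict homogeneous_mult mult.commute[of d c])

text \<open>The power \<open>k\<close> is fixed, and \<open>j\<close> is the one index whose
  function contributes to it; the formal sum then has a single term at that power.\<close>

lemma formal_sum_eq:
  assumes a: "\<And>n. a n \<in> lin_end V"
    and \<phi>: "\<And>n. fls_nth (laurent_expansion (\<phi> n) 0) k = (if n = j then c else 0)"
  shows "formal_sum V N \<phi> a k = (\<lambda>w\<in>carrier V. if j \<in> N then c \<odot>\<^bsub>V\<^esub> a j w else \<zero>\<^bsub>V\<^esub>)"
proof -
  have "gfinsum V (\<lambda>n. (if n = j then c else 0) \<odot>\<^bsub>V\<^esub> a n w) N
      = (if j \<in> N then c \<odot>\<^bsub>V\<^esub> a j w else \<zero>\<^bsub>V\<^esub>)" if "w \<in> carrier V" for w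
    using that a by (subst gfinsum_single[where j = j]) (auto simp: lin_endD)
  then show ?thesis by (auto simp: fun_eq_iff formal_sum_def \<phi>)
qed

end

subsection \<open>Residues and Laurent expansions\<close>

lemma has_laurent_expansion_deriv_powi:
  "deriv (\<lambda>z. z powi n) has_laurent_expansion (fls_const (of_int n) * fls_X_intpow (n - 1))"
proof -
  have "deriv (\<lambda>z::complex. z powi n) has_laurent_expansion fls_deriv (fls_X_intpow n)"
    by (intro laurent_expansion_intros)
  also have "fls_deriv (fls_X_intpow n) = fls_const (of_int n) * (fls_X_intpow (n - 1) :: complex fls)"
    proof (rule fls_eqI)
    fix k
    show "fls_nth (fls_deriv (fls_X_intpow n)) k
        = fls_nth (fls_const (of_int n) * (fls_X_intpow (n - 1) :: complex fls)) k"
      by (cases "k = n - 1") auto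
  qed
  finally show ?thesis .
qed

text \<open>The form is \<open>n z^(m+n-1) dz\<close>, with a residue only when
  \<open>m + n = 0\<close>. Both the cocycle and the translation coefficients are instances.\<close>

lemma residue_powi_deriv_powi:
  "residue (\<lambda>z. z powi m * deriv (\<lambda>z. z powi n) z) 0 = (if n = - m then of_int n else 0)"
proof -
  have "(\<lambda>z. z powi m * deriv (\<lambda>z. z powi n) z) has_laurent_expansion
      fls_X_intpow m * (fls_const (of_int n) * fls_X_intpow (n - 1))"
    by (intro laurent_expansion_intros has_laurent_expansion_deriv_powi)
  then have "residue (\<lambda>z. z powi m * deriv (\<lambda>z. z powi n) z) 0
      = fls_residue (fls_X_intpow m * (fls_const (of_int n) * fls_X_intpow (n - 1)))"
    by (rule has_laurent_expansion_residue_0)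
  also have "\<dots> = (if n = - m then of_int n else 0)"
    by (auto simp: fls_X_intpow_times_conv_shift)
  finally show ?thesis .
qed

lemma kn_gamma_eq: "kn_gamma n m = (if n = - m then of_int n else 0)"
  unfolding kn_gamma_def kn_Res_def kn_A_def kn_d_def by (simp add: residue_powi_deriv_powi)

lemma kn_basis_eq: "kn_basis n = (\<lambda>z. z powi (- n - 1))"
  by (simp add: fun_eq_iff kn_pairing_def kn_omega_def kn_e_def)

text \<open>The residue formula for \<open>z^(-n-1) d(z^m)\<close>, which forces
  \<open>m = n + 1\<close>.\<close>

lemma kn_xi_eq: "kn_xi m n = (if n = m - 1 then - of_int m else 0)"
  unfolding kn_xi_def kn_Res_def kn_A_def kn_d_def kn_basis_eq
  by (auto simp: residue_powi_deriv_powi)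

text \<open>Read as a function of \<open>n\<close> at fixed \<open>k\<close>, the form that
  \<open>formal_sum_eq\<close> takes; the surviving index is that of the reindexing in
  \<open>of_modes\<close>.\<close>

lemma kn_basis_nth: "fls_nth (laurent_expansion (kn_basis n) 0) k = (if n = - k - 1 then 1 else 0)"
proof -
  have "laurent_expansion (kn_basis n) 0 = fls_X_intpow (- n - 1)"
    unfolding kn_basis_eq by (intro laurent_expansion_0_eqI laurent_expansion_intros)
  then show ?thesis by auto
qed

lemma kn_lie_powi_nth:
  "fls_nth (laurent_expansion (kn_lie (\<lambda>z. z powi n)) 0) k = (if n = k + 1 then of_int (k + 1) else 0)"
proof -
  have "laurent_expansion (kn_lie (\<lambda>z. z powi n)) 0 = fls_const (of_int n) * fls_X_intpow (n - 1)"
    unfolding kn_lie_def by (intro laurent_expansion_0_eqI has_laurent_expansion_deriv_powi)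
  then show ?thesis by auto
qed

subsection \<open>Comparison of the two vertex algebras\<close>

text \<open>Space, vacuum and generators are built from the bracket alone, so this equality of
  functions makes them literally equal, not just isomorphic.\<close>

lemma kn_bracket_eq: "kn_bracket = heis_bracket"
  unfolding kn_bracket_def heis_bracket_def by (simp add: kn_gamma_eq fun_eq_iff central_bracket_def)

lemma heis_bracket_gen:
  "heis_bracket (heis_gen n) (heis_gen m) =
     Poly_Mapping.single Central (if n = - m then of_int n else 0)"
  by (simp add: heis_bracket_def central_bracket_def heis_gen_def)

lemma kn_space_eq: "kn_space = heis_space"
  by (simp add: kn_space_def heis_space_def kn_bracket_eq)

lemma kn_vacuum_eq: "kn_vacuum = heis_vacuum"
  by (simp add: kn_vacuum_def heis_vacuum_def kn_bracket_eq)

lemma kn_op_eq: "kn_op = heis_op"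
  by (simp add: kn_op_def heis_op_def kn_bracket_eq)

text \<open>Every bracket is a multiple of \<open>Central\<close>, which lies in
  \<open>plus_basis\<close>; this gives both closure conditions.\<close>

interpretation heis: induced_from_subalgebra UNIV heis_bracket plus_basis fock_char
  by unfold_locales
    (auto simp: bracket_closed_def heis_bracket_def central_bracket_def plus_basis_def)

interpretation heis: complex_space heis_space
  unfolding complex_space_def heis_space_def fock_module_def by (rule heis.module_V)

lemma heis_op_lin_end: "heis_op n \<in> lin_end heis_space"
  unfolding heis_op_def fock_op_def heis_space_def fock_module_def
  by (rule heis.action_lin_end) simp

section \<open>Fields and normal ordered products\<close>

text \<open>Taken for a general index set \<open>N\<close>, so that it covers the full expansion as
  well as the two halves in the normal ordered product.\<close>

lemma formal_sum_kn_basis: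
  assumes "\<And>n. a n \<in> lin_end heis_space"
  shows "formal_sum heis_space N kn_basis a = modes_restrict heis_space N (of_modes a)"
proof
  fix k
  have "formal_sum heis_space N kn_basis a k =
      (\<lambda>w\<in>carrier heis_space. if - k - 1 \<in> N then 1 \<odot>\<^bsub>heis_space\<^esub> a (- k - 1) w else \<zero>\<^bsub>heis_space\<^esub>)"
    by (rule heis.formal_sum_eq[OF assms kn_basis_nth])
  \<comment> \<open>Elements of \<open>lin_end\<close> are extensional, so restricting the
    coefficient to the carrier returns it unchanged.\<close>
  also have "\<dots> = modes_restrict heis_space N (of_modes a) k"
    using assms[of "- k - 1"] heis.lin_end_restrict[OF assms[of "- k - 1"]]
    by (auto simp: modes_restrict_def of_modes_def modes_def heis.lin_endD cong: restrict_cong)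
  finally show "formal_sum heis_space N kn_basis a k = modes_restrict heis_space N (of_modes a) k" .
qed

lemma modes_restrict_UNIV: "modes_restrict V UNIV f = f"
  by (simp add: fun_eq_iff modes_restrict_def of_modes_def modes_def)

lemma of_modes_modes: "of_modes (modes f) = f" and modes_of_modes: "modes (of_modes a) = a"
  by (simp_all add: fun_eq_iff of_modes_def modes_def)

lemma kn_current_eq: "kn_current = heis_current"
  by (simp add: kn_current_def heis_current_def kn_space_eq kn_op_eq formal_sum_kn_basis
      heis_op_lin_end modes_restrict_UNIV)

lemma kn_nabla_eq:
  assumes "\<And>k. f k \<in> lin_end heis_space"
  shows "kn_nabla f = series_deriv heis_space f"
proof
  fix k
  show "kn_nabla f k = series_deriv heis_space f k"
    unfolding kn_nabla_def kn_space_eq series_deriv_def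
    by (subst heis.formal_sum_eq[OF assms kn_lie_powi_nth]) simp
qed

lemma series_deriv_lin_end:
  "(\<And>k. f k \<in> lin_end heis_space) \<Longrightarrow> series_deriv heis_space f k \<in> lin_end heis_space"
  unfolding series_deriv_def by (rule heis.lin_end_scale)

lemma series_scale_lin_end:
  "(\<And>k. f k \<in> lin_end heis_space) \<Longrightarrow> series_scale heis_space c f k \<in> lin_end heis_space"
  unfolding series_scale_def by (rule heis.lin_end_scale)

abbreviation current_deriv :: "nat \<Rightarrow> state series" where
  "current_deriv n \<equiv> (series_deriv heis_space ^^ n) heis_current"

lemma current_deriv_lin_end: "current_deriv n k \<in> lin_end heis_space"
proof (induction n arbitrary: k)
  case 0
  then show ?case by (simp add: heis_current_def of_modes_def heis_op_lin_end)
next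
  case (Suc n)
  then show ?case by (simp add: series_deriv_lin_end)
qed

lemma kn_nabla_power: "(kn_nabla ^^ n) kn_current = current_deriv n"
  by (induction n) (simp_all add: kn_current_eq kn_nabla_eq current_deriv_lin_end)

text \<open>The description by \<open>THE\<close> has a unique solution: on linear modes the KN
  expansion is \<open>of_modes\<close>, which \<open>modes\<close> inverts.\<close>

lemma kn_modes_eq:
  assumes "\<And>k. f k \<in> lin_end heis_space"
  shows "kn_modes f = modes f"
  unfolding kn_modes_def kn_space_eq
proof (rule the_equality)
  have *: "modes f n \<in> lin_end heis_space" for n using assms by (simp add: modes_def)
  then show "(\<forall>n. modes f n \<in> lin_end heis_space) \<and> formal_sum heis_space UNIV kn_basis (modes f) = f"
    by (simp add: formal_sum_kn_basis modes_restrict_UNIV of_modes_modes)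
next
  fix a assume "(\<forall>n. a n \<in> lin_end heis_space) \<and> formal_sum heis_space UNIV kn_basis a = f"
  then have "\<And>n. a n \<in> lin_end heis_space" and "formal_sum heis_space UNIV kn_basis a = f"
    by simp_all
  then have "of_modes a = f" by (simp add: formal_sum_kn_basis modes_restrict_UNIV)
  then show "a = modes f" by (auto simp: modes_of_modes)
qed

text \<open>Only the first factor is split into modes, so linearity is asked of \<open>f\<close>. In
  a nested product \<open>g\<close> is itself a normal ordered product.\<close>

lemma kn_nop_eq:
  assumes "\<And>k. f k \<in> lin_end heis_space"
  shows "kn_nop f g = series_nop heis_space f g"
proof -
  have "modes f n \<in> lin_end heis_space" for n using assms by (simp add: modes_def)
  then show ?thesis
    using assms
    by (simp add: kn_nop_def series_nop_def kn_space_eq kn_modes_eq formal_sum_kn_basis of_modes_modes)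
qed

lemma homogeneous_nested_nop:
  "homogeneous heis_space (nested_nop (map current_deriv ns))"
proof (induction ns rule: kn_field.induct)
  case 1
  then show ?case by (simp add: homogeneous_def series_one_def)
next
  case (2 n)
  then show ?case by (simp add: heis.homogeneous_lin_end current_deriv_lin_end)
next
  case (3 n n' ns)
  then show ?case
    by (simp add: heis_nop_eq heis.homogeneous_nop heis.homogeneous_lin_end current_deriv_lin_end)
qed

lemma kn_field_single:
  "kn_field [n] = series_scale heis_space (1 / fact n) (current_deriv n)"
  by (simp add: kn_space_eq kn_nabla_power)

text \<open>Induction along the right nesting; the scalar of the head is merged with the one already
  collected from the tail.\<close>

lemma kn_field_eq: "kn_field ns = heis_field ns"
proof (induction ns rule: kn_field.induct)
  case 1
  then show ?case
    by (auto simp: heis_field_def kn_space_eq series_scale_def series_one_def fun_eq_iff)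
next
  case (2 n)
  then show ?case unfolding kn_field_single by (simp add: heis_field_def)
next
  case (3 n n' ns)
  have "kn_field (n # n' # ns) =
      series_nop heis_space (series_scale heis_space (1 / fact n) (current_deriv n)) (heis_field (n' # ns))"
    \<comment> \<open>\<open>3(2)\<close> is the induction hypothesis for the tail. The head is
      rewritten to a scaled derivative of the current, whose coefficients are linear as
      \<open>kn_nop_eq\<close> requires.\<close>
    unfolding kn_field.simps(3) kn_field_single 3(2)
    by (rule kn_nop_eq) (intro series_scale_lin_end current_deriv_lin_end)
  \<comment> \<open>Both factors are now scaled series, and their scalars multiply to the inverse
    factorial product of the longer list.\<close>
  also have "\<dots> = heis_field (n # n' # ns)"
    unfolding heis_field_def
    by (subst heis.series_nop_scale[OF heis.homogeneous_lin_end[OF current_deriv_lin_end] homogeneous_nested_nop])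
      (simp add: heis_nop_eq)
  finally show ?case .
qed

section \<open>Translation operators and vertex maps\<close>

text \<open>In the sum over \<open>n\<close> only \<open>n = m - 1\<close> survives, with
  coefficient \<open>- m\<close>, so both predicates impose the same commutation rule.\<close>

lemma is_kn_translation_iff: "is_kn_translation T \<longleftrightarrow> is_heis_translation T"
proof -
  have "gfinsum heis_space (\<lambda>n. kn_xi m n \<odot>\<^bsub>heis_space\<^esub> heis_op n w) UNIV
      = of_int (- m) \<odot>\<^bsub>heis_space\<^esub> heis_op (m - 1) w" if "w \<in> carrier heis_space" for m w
    using that by (subst heis.gfinsum_single[where j = "m - 1"])
      (auto simp: kn_xi_eq heis.lin_endD heis_op_lin_end)
  then show ?thesis
    by (simp add: is_kn_translation_def is_heis_translation_def is_translation_def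
        kn_space_eq kn_vacuum_eq kn_op_eq)
qed

lemma is_kn_vertex_map_eq: "is_kn_vertex_map = is_heis_vertex_map"
proof -
  have "kn_field = heis_field" by (simp add: fun_eq_iff kn_field_eq)
  then show ?thesis
    by (simp add: is_kn_vertex_map_def is_heis_vertex_map_def kn_space_eq kn_vacuum_eq kn_op_eq)
qed

theorem mainTheorem2:
  shows "(\<forall>n m. kn_bracket (heis_gen n) (heis_gen m) =
            Poly_Mapping.single Central (if n = - m then of_int n else 0)) \<and>
         kn_bracket = heis_bracket \<and>
         kn_space = heis_space \<and>
         kn_vacuum = heis_vacuum \<and>
         (\<forall>T. is_kn_translation T \<longleftrightarrow> is_heis_translation T) \<and>
         kn_translation = heis_translation \<and>
         (\<forall>ns. sorted_wrt (\<ge>) ns \<longrightarrow> kn_field ns = heis_field ns) \<and>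
         (\<forall>Y. is_kn_vertex_map Y \<longleftrightarrow> is_heis_vertex_map Y) \<and>
         kn_Y = heis_Y"
  \<comment> \<open>The translation operators and the vertex maps are selected by \<open>THE\<close>
    from predicates already shown to agree, hence they coincide.\<close>
  using heis_bracket_gen
  by (simp add: kn_bracket_eq kn_space_eq kn_vacuum_eq is_kn_translation_iff kn_field_eq
      is_kn_vertex_map_eq kn_translation_def heis_translation_def kn_Y_def heis_Y_def)

end
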